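(* Let $X$ be a complex Banach space with $\dim X>1$ such that its dual $X^{\ast}$ is separable, let $(J,\|\cdot\|_{J})$ be a separable admissible Banach ideal of $\mathcal{B}(X)$, and let $T\in\mathcal{B}(X)$. Then $T$ satisfies the supercyclicity criterion on $X$ if and only if the left multiplication operator $L_{T}:J\to J$, $L_{T}(A)=TA$, is supercyclic on $(J,\|\cdot\|_{J})$.
   Context: $\mathcal{B}(X)$ is the algebra of bounded linear operators on $X$. Supercyclic: a bounded linear operator $T$ on a Banach space $Y$ is supercyclic if there is $y\in Y$ such that $\{\alpha T^{n}y:\alpha\in\mathbb{C},\,n\in\mathbb{N}\}$ is dense in $Y$. Supercyclicity criterion: a bounded linear operator $T$ on a Banach space $Y$ satisfies the supercyclicity criterion if there exist two dense subsets $D_1,D_2$ of $Y$, a sequence $(n_k)_{k\ge 0}$ of positive integers, and mappings $S_{n_k}:D_2\to Y$ such that (i) $\|T^{n_k}x\|\,\|S_{n_k}y\|\to 0$ for every $x\in D_1$ and $y\in D_2$; (ii) $T^{n_k}S_{n_k}y\to y$ for every $y\in D_2$. Rank one operators: for $x\in X$, $x^{\ast}\in X^{\ast}$, $(x\otimes x^{\ast})(z)=x^{\ast}(z)x$ for $z\in X$. $\mathcal{F}(X)$ is the linear span of the rank one operators. Banach ideal: $(J,\|\cdot\|_J)$ is a Banach ideal of $\mathcal{B}(X)$ if (i) $J\subset\mathcal{B}(X)$ is a linear subspace; (ii) $\|\cdot\|_J$ is a complete norm on $J$ and $\|S\|\le\|S\|_J$ for all $S\in J$; (iii) for all $S\in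 J$ and $A,B\in\mathcal{B}(X)$, $ASB\in J$ and $\|ASB\|_J\le\|A\|\,\|S\|_J\,\|B\|$; (iv) $x\otimes x^{\ast}\in J$ and $\|x\otimes x^{\ast}\|_J=\|x\|\,\|x^{\ast}\|$ for all $x\in X$, $x^{\ast}\in X^{\ast}$. It is admissible if $\mathcal{F}(X)$ is dense in $J$ with respect to $\|\cdot\|_J$. Separability of $J$ is with respect to $\|\cdot\|_J$. *)

theory Defs
  imports "HOL-Analysis.Analysis"
begin

section \<open>Complex normed and Banach spaces\<close>

text \<open>The library only has real vector space classes; the complex structure is added on top of
  them, compatibly with the real one.\<close>

class scaleC =
  fixes scaleC :: "complex \<Rightarrow> 'a \<Rightarrow> 'a" (infixr "*\<^sub>C" 75)

class complex_vector = real_vector + scaleC +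
  assumes scaleC_add_right: "a *\<^sub>C (x + y) = a *\<^sub>C x + a *\<^sub>C y"
    and scaleC_add_left: "(a + b) *\<^sub>C x = a *\<^sub>C x + b *\<^sub>C x"
    and scaleC_scaleC: "a *\<^sub>C b *\<^sub>C x = (a * b) *\<^sub>C x"
    and scaleC_one: "1 *\<^sub>C x = x"
    and scaleR_scaleC: "r *\<^sub>R x = complex_of_real r *\<^sub>C x"

class complex_normed_vector = complex_vector + real_normed_vector +
  assumes norm_scaleC: "norm (a *\<^sub>C x) = cmod a * norm x"

class complex_banach = complex_normed_vector + banach

global_interpretation complex_vector: vector_space "scaleC :: complex \<Rightarrow> 'a \<Rightarrow> 'a::complex_vector"
  by unfold_locales (rule scaleC_add_right scaleC_add_left scaleC_scaleC scaleC_one)+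

abbreviation clinear :: "('a::complex_vector \<Rightarrow> 'b::complex_vector) \<Rightarrow> bool" where
  "clinear \<equiv> Vector_Spaces.linear scaleC scaleC"

instantiation complex :: complex_banach
begin
definition scaleC_complex :: "complex \<Rightarrow> complex \<Rightarrow> complex" where
  "scaleC_complex a x = a * x"
instance
  by standard (auto simp: scaleC_complex_def algebra_simps norm_mult scaleR_conv_of_real)
end

lemma bounded_linear_scaleC_right: "bounded_linear (\<lambda>x :: 'a::complex_normed_vector. c *\<^sub>C x)"
  by (rule bounded_linear_intro[where K = "cmod c"])
     (simp_all add: scaleC_add_right scaleR_scaleC scaleC_scaleC norm_scaleC mult.commute)

lemma bounded_linear_scaleC_left: "bounded_linear (\<lambda>c. c *\<^sub>C (x :: 'a::complex_normed_vector))"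
  by (rule bounded_linear_intro[where K = "norm x"])
     (simp_all add: scaleC_add_left scaleR_scaleC scaleC_scaleC norm_scaleC scaleC_complex_def)

section \<open>Bounded operators and functionals\<close>

instantiation blinfun :: (real_normed_vector, complex_normed_vector) complex_normed_vector
begin
lift_definition scaleC_blinfun :: "complex \<Rightarrow> 'a \<Rightarrow>\<^sub>L 'b \<Rightarrow> 'a \<Rightarrow>\<^sub>L 'b" is "\<lambda>c f x. c *\<^sub>C f x"
  by (rule bounded_linear_compose[OF bounded_linear_scaleC_right])
instance
proof
  fix a b :: complex and r :: real and f g :: "'a \<Rightarrow>\<^sub>L 'b"
  show "a *\<^sub>C (f + g) = a *\<^sub>C f + a *\<^sub>C g" by transfer (simp add: scaleC_add_right)
  show "(a + b) *\<^sub>C f = a *\<^sub>C f + b *\<^sub>C f" by transfer (simp add: scaleC_add_left)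
  show "a *\<^sub>C b *\<^sub>C f = (a * b) *\<^sub>C f" by transfer (simp add: scaleC_scaleC)
  show "1 *\<^sub>C f = f" by transfer (simp add: scaleC_one)
  show "r *\<^sub>R f = complex_of_real r *\<^sub>C f" by transfer (simp add: scaleR_scaleC)
  have le: "norm (c *\<^sub>C h) \<le> cmod c * norm h" for c and h :: "'a \<Rightarrow>\<^sub>L 'b"
  proof (rule norm_blinfun_bound)
    fix x show "norm ((c *\<^sub>C h) x) \<le> cmod c * norm h * norm x"
      using mult_left_mono[OF norm_blinfun[of h x], of "cmod c"]
      by (simp add: scaleC_blinfun.rep_eq norm_scaleC mult.assoc)
  qed simp
  show "norm (a *\<^sub>C f) = cmod a * norm f"
  proof (cases "a = 0")
    case True
    then show ?thesis using le[of 0 f] by simp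
  next
    case False
    have "inverse a *\<^sub>C a *\<^sub>C f = f"
      using False by transfer (simp add: scaleC_scaleC scaleC_one)
    then have "norm f \<le> cmod (inverse a) * norm (a *\<^sub>C f)"
      using le[of "inverse a" "a *\<^sub>C f"] by simp
    then have "cmod a * norm f \<le> norm (a *\<^sub>C f)"
      using False mult_left_mono[of "norm f" "cmod (inverse a) * norm (a *\<^sub>C f)" "cmod a"]
      by (simp add: norm_inverse mult.assoc[symmetric] del: inverse_eq_divide)
    then show ?thesis using le[of a f] by simp
  qed
qed
end

text \<open>The library type of bounded linear maps is the real one, so complex linearity is imposed
  separately. The norm is the operator norm.\<close>

definition bounded_operators :: "('a::complex_normed_vector \<Rightarrow>\<^sub>L 'a) set" where
  "bounded_operators = {A. clinear (blinfun_apply A)}"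

definition dual_space :: "('a::complex_normed_vector \<Rightarrow>\<^sub>L complex) set" where
  "dual_space = {f. clinear (blinfun_apply f)}"

lift_definition rank_one ::
    "'a::complex_normed_vector \<Rightarrow> ('a \<Rightarrow>\<^sub>L complex) \<Rightarrow> ('a \<Rightarrow>\<^sub>L 'a)" (infix "\<otimes>\<^sub>r" 70)
  is "\<lambda>x f z. f z *\<^sub>C x"
  by (rule bounded_linear_compose[OF bounded_linear_scaleC_left])

definition finite_rank_operators :: "('a::complex_normed_vector \<Rightarrow>\<^sub>L 'a) set" where
  "finite_rank_operators = complex_vector.span {x \<otimes>\<^sub>r f | x f. f \<in> dual_space}"

section \<open>Subspaces with their own norm\<close>

text \<open>Below, a normed space is given by a carrier \<open>Y\<close> and a norm function \<open>N\<close> that is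
  only meaningful on \<open>Y\<close>; whole types are the case \<open>Y = UNIV\<close>, \<open>N = norm\<close>.\<close>

definition dense_wrt :: "'v::complex_vector set \<Rightarrow> ('v \<Rightarrow> real) \<Rightarrow> 'v set \<Rightarrow> bool" where
  "dense_wrt Y N D \<longleftrightarrow> D \<subseteq> Y \<and> (\<forall>y\<in>Y. \<forall>e>0. \<exists>d\<in>D. N (y - d) < e)"

definition separable_wrt :: "'v::complex_vector set \<Rightarrow> ('v \<Rightarrow> real) \<Rightarrow> bool" where
  "separable_wrt Y N \<longleftrightarrow> (\<exists>D. countable D \<and> dense_wrt Y N D)"

locale complete_norm_on =
  fixes Y :: "'v::complex_vector set" and N :: "'v \<Rightarrow> real"
  assumes subspace: "complex_vector.subspace Y"
    and nonneg: "x \<in> Y \<Longrightarrow> 0 \<le> N x"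
    and eq_zero_iff: "x \<in> Y \<Longrightarrow> N x = 0 \<longleftrightarrow> x = 0"
    and triangle: "x \<in> Y \<Longrightarrow> y \<in> Y \<Longrightarrow> N (x + y) \<le> N x + N y"
    and homogeneous: "x \<in> Y \<Longrightarrow> N (c *\<^sub>C x) = cmod c * N x"
    and complete: "(\<And>n. u n \<in> Y) \<Longrightarrow> (\<forall>e>0. \<exists>M. \<forall>m\<ge>M. \<forall>n\<ge>M. N (u m - u n) < e)
        \<Longrightarrow> \<exists>l\<in>Y. (\<lambda>n. N (u n - l)) \<longlonglongrightarrow> 0"

section \<open>Supercyclicity\<close>

text \<open>Both notions are meant for a bounded linear operator \<open>T\<close> of the Banach space
  \<open>(Y, N)\<close> into itself.\<close>

definition supercyclic ::
    "'v::complex_vector set \<Rightarrow> ('v \<Rightarrow> real) \<Rightarrow> ('v \<Rightarrow> 'v) \<Rightarrow> bool" where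
  "supercyclic Y N T \<longleftrightarrow> (\<exists>y\<in>Y. dense_wrt Y N {\<alpha> *\<^sub>C (T ^^ n) y | \<alpha> n. True})"

definition supercyclicity_criterion ::
    "'v::complex_vector set \<Rightarrow> ('v \<Rightarrow> real) \<Rightarrow> ('v \<Rightarrow> 'v) \<Rightarrow> bool" where
  "supercyclicity_criterion Y N T \<longleftrightarrow>
    (\<exists>D1 D2 (n :: nat \<Rightarrow> nat) (S :: nat \<Rightarrow> 'v \<Rightarrow> 'v).
      dense_wrt Y N D1 \<and> dense_wrt Y N D2 \<and> (\<forall>k. n k > 0) \<and>
      (\<forall>k. \<forall>y\<in>D2. S (n k) y \<in> Y) \<and>
      (\<forall>x\<in>D1. \<forall>y\<in>D2. (\<lambda>k. N ((T ^^ n k) x) * N (S (n k) y)) \<longlonglongrightarrow> 0) \<and>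
      (\<forall>y\<in>D2. (\<lambda>k. N ((T ^^ n k) (S (n k) y) - y)) \<longlonglongrightarrow> 0))"

section \<open>Banach ideals\<close>

locale banach_ideal = complete_norm_on J N
  for J :: "('a::complex_banach \<Rightarrow>\<^sub>L 'a) set" and N :: "('a \<Rightarrow>\<^sub>L 'a) \<Rightarrow> real" +
  assumes operators: "J \<subseteq> bounded_operators"
    and norm_le: "S \<in> J \<Longrightarrow> norm S \<le> N S"
    and ideal: "S \<in> J \<Longrightarrow> A \<in> bounded_operators \<Longrightarrow> B \<in> bounded_operators
        \<Longrightarrow> A o\<^sub>L S o\<^sub>L B \<in> J"
    and ideal_norm: "S \<in> J \<Longrightarrow> A \<in> bounded_operators \<Longrightarrow> B \<in> bounded_operators
        \<Longrightarrow> N (A o\<^sub>L S o\<^sub>L B) \<le> norm A * N S * norm B"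
    and rank_one_in: "f \<in> dual_space \<Longrightarrow> x \<otimes>\<^sub>r f \<in> J"
    and rank_one_norm: "f \<in> dual_space \<Longrightarrow> N (x \<otimes>\<^sub>r f) = norm x * norm f"

locale admissible_banach_ideal = banach_ideal +
  assumes finite_rank_dense: "dense_wrt J N finite_rank_operators"

definition left_mult :: "('a::complex_normed_vector \<Rightarrow>\<^sub>L 'a) \<Rightarrow> ('a \<Rightarrow>\<^sub>L 'a) \<Rightarrow> ('a \<Rightarrow>\<^sub>L 'a)" where
  "left_mult T A = T o\<^sub>L A"

end

theory Submission
  imports Defs
begin

text \<open>Both directions compare \<open>T\<close> acting on vectors with \<open>T\<close> acting on rank one operators, through
  \<open>L\<^sub>T (x \<otimes> f) = T x \<otimes> f\<close> and \<open>\<parallel>x \<otimes> f\<parallel> = \<parallel>x\<parallel> \<parallel>f\<parallel>\<close>.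

  If \<open>T\<close> satisfies the criterion, tensoring its data with functionals transports them to \<open>J\<close>: finite
  sums of operators \<open>x \<otimes> f\<close> with \<open>x\<close> in \<open>D\<^sub>1\<close> (or in \<open>D\<^sub>2\<close>) are dense in \<open>J\<close> by admissibility,
  and \<open>\<Sum> S y\<^sub>i \<otimes> f\<^sub>i\<close> is an approximate preimage of \<open>\<Sum> y\<^sub>i \<otimes> f\<^sub>i\<close>. If \<open>A\<close> and \<open>B\<close> are such
  sums and \<open>C\<close> is the approximate preimage of \<open>B\<close>, a suitable scalar \<open>r > 0\<close> makes
  \<open>A + C / r\<close> close to \<open>A\<close> and its image under \<open>r L\<^sub>T\<^sup>n\<close> close to \<open>B\<close>. So every nonempty open
  set can be moved to meet every other (\<open>criterion_imp_transitive\<close>), and in the separable complete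
  space \<open>J\<close> Baire's theorem turns this into a supercyclic vector
  (\<open>transitive_imp_supercyclic\<close>).

  Conversely, let \<open>R\<close> be a supercyclic vector of \<open>L\<^sub>T\<close>. As the dimension is at least two, the
  Hahn-Banach theorem yields vectors \<open>a\<close>, \<open>b\<close> and a biorthogonal pair of functionals
  (\<open>biorthogonal_pair\<close>). The evaluation \<open>A \<mapsto> (A a, A b)\<close> is then a continuous map of \<open>J\<close> onto
  \<open>X \<times> X\<close>, so \<open>(x, y) = (R a, R b)\<close> is a supercyclic vector of \<open>T \<oplus> T\<close>. Approximating \<open>(0, s x)\<close>
  for large \<open>s\<close> by \<open>\<alpha> (T\<^sup>n x, T\<^sup>n y)\<close> gives at once \<open>\<alpha> T\<^sup>n x \<approx> 0\<close> and a small vector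
  \<open>y / s\<close> with \<open>\<alpha> T\<^sup>n (y / s) \<approx> x\<close>. Because \<open>T\<close> commutes with its powers, these two facts at
  \<open>x\<close> spread over the dense set of all \<open>\<beta> T\<^sup>m x\<close>, which serves as both \<open>D\<^sub>1\<close> and \<open>D\<^sub>2\<close>
  (\<open>dense_diagonal_orbit_imp_criterion\<close>).\<close>

section \<open>Separating points by functionals\<close>

text \<open>Only the inequality for positive scalars is demanded, which keeps the verification for infima
  short; equality follows by applying it to \<open>t\<close> and to \<open>1 / t\<close> (\<open>sublinear_scale\<close>).\<close>
definition sublinear :: "('a::real_vector \<Rightarrow> real) \<Rightarrow> bool" where
  "sublinear q \<longleftrightarrow> (\<forall>x y. q (x + y) \<le> q x + q y) \<and> (\<forall>t>0. \<forall>x. q (t *\<^sub>R x) \<le> t * q x)"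

lemma sublinear_add: "sublinear q \<Longrightarrow> q (x + y) \<le> q x + q y"
  by (simp add: sublinear_def)

lemma sublinear_zero:
  assumes "sublinear q"
  shows "q 0 = 0"
proof -
  have "q (0 + 0) \<le> q 0 + q 0" using assms unfolding sublinear_def by blast
  moreover have "q ((1/2) *\<^sub>R 0) \<le> 1/2 * q 0"
    using assms unfolding sublinear_def by (metis half_gt_zero zero_less_one)
  ultimately show ?thesis by simp
qed

lemma sublinear_scale:
  assumes "sublinear q" "0 \<le> t"
  shows "q (t *\<^sub>R x) = t * q x"
proof (cases "t = 0")
  case True
  then show ?thesis using sublinear_zero[OF assms(1)] by simp
next
  case False
  then have t: "t > 0" using assms by simp
  have 1: "q (t *\<^sub>R x) \<le> t * q x" using assms t by (simp add: sublinear_def)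
  have "q (inverse t *\<^sub>R t *\<^sub>R x) \<le> inverse t * q (t *\<^sub>R x)"
    using assms t unfolding sublinear_def by (meson inverse_positive_iff_positive)
  then have "t * q x \<le> q (t *\<^sub>R x)" using t by (simp add: field_simps)
  with 1 show ?thesis by simp
qed

lemma sublinear_ge:
  assumes "sublinear q"
  shows "- q (- x) \<le> q x"
  using sublinear_add[OF assms, of x "- x"] sublinear_zero[OF assms] by simp

text \<open>For sublinear \<open>q\<close>, the largest sublinear functional below \<open>q\<close> whose value at \<open>- y\<close> is \<open>- q y\<close>. It is used twice: to see that minimal sublinear
  functionals are linear, and to prescribe the value of a linear functional at one vector.\<close>
definition lower_along :: "('a::real_vector \<Rightarrow> real) \<Rightarrow> 'a \<Rightarrow> 'a \<Rightarrow> real" where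
  "lower_along q y x = (INF t\<in>{0..}. q (x + t *\<^sub>R y) - t * q y)"

lemma lower_along_le:
  assumes "sublinear q" "0 \<le> t"
  shows "lower_along q y x \<le> q (x + t *\<^sub>R y) - t * q y"
  unfolding lower_along_def
proof (rule cINF_lower)
  have "- q (- x) \<le> q (x + t *\<^sub>R y) - t * q y" if "0 \<le> t" for t
    using sublinear_add[OF assms(1), of "x + t *\<^sub>R y" "- x"] sublinear_scale[OF assms(1) that, of y]
    by simp
  then show "bdd_below ((\<lambda>t. q (x + t *\<^sub>R y) - t * q y) ` {0..})"
    by (intro bdd_belowI2[where m = "- q (- x)"]) auto
qed (use assms in auto)

lemma lower_along_greatest:
  assumes "\<And>t. 0 \<le> t \<Longrightarrow> c \<le> q (x + t *\<^sub>R y) - t * q y"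
  shows "c \<le> lower_along q y x"
  unfolding lower_along_def by (rule cINF_greatest) (use assms in auto)

lemma lower_along_le_self: "sublinear q \<Longrightarrow> lower_along q y x \<le> q x"
  using lower_along_le[of q 0 y x] by simp

lemma sublinear_lower_along:
  assumes q: "sublinear q"
  shows "sublinear (lower_along q y)"
  unfolding sublinear_def
proof (intro conjI allI impI)
  fix x z
  have "lower_along q y (x + z) - (q (z + t *\<^sub>R y) - t * q y) \<le> lower_along q y x" if t: "0 \<le> t" for t
  proof (rule lower_along_greatest)
    fix s :: real assume s: "0 \<le> s"
    have "lower_along q y (x + z) \<le> q (x + z + (s + t) *\<^sub>R y) - (s + t) * q y"
      using s t by (intro lower_along_le q) simp
    also have "x + z + (s + t) *\<^sub>R y = (x + s *\<^sub>R y) + (z + t *\<^sub>R y)"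
      by (simp add: algebra_simps)
    also have "q \<dots> - (s + t) * q y \<le> (q (x + s *\<^sub>R y) - s * q y) + (q (z + t *\<^sub>R y) - t * q y)"
      using sublinear_add[OF q, of "x + s *\<^sub>R y" "z + t *\<^sub>R y"] by (simp add: algebra_simps)
    finally show "lower_along q y (x + z) - (q (z + t *\<^sub>R y) - t * q y) \<le> q (x + s *\<^sub>R y) - s * q y"
      by simp
  qed
  then have "lower_along q y (x + z) - lower_along q y x \<le> lower_along q y z"
    by (intro lower_along_greatest) (simp add: algebra_simps)
  then show "lower_along q y (x + z) \<le> lower_along q y x + lower_along q y z" by simp
next
  fix r :: real and x assume r: "0 < r"
  have "lower_along q y (r *\<^sub>R x) / r \<le> lower_along q y x"
  proof (rule lower_along_greatest)
    fix t :: real assume t: "0 \<le> t"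
    have "lower_along q y (r *\<^sub>R x) \<le> q (r *\<^sub>R x + (r * t) *\<^sub>R y) - r * t * q y"
      using r t by (intro lower_along_le q) simp
    also have "r *\<^sub>R x + (r * t) *\<^sub>R y = r *\<^sub>R (x + t *\<^sub>R y)" by (simp add: algebra_simps)
    also have "q \<dots> = r * q (x + t *\<^sub>R y)" using r by (intro sublinear_scale q) simp
    finally show "lower_along q y (r *\<^sub>R x) / r \<le> q (x + t *\<^sub>R y) - t * q y"
      using r by (simp add: field_simps)
  qed
  then show "lower_along q y (r *\<^sub>R x) \<le> r * lower_along q y x" using r by (simp add: field_simps)
qed

text \<open>Minimality forces \<open>lower_along q y = q\<close>, and its value for \<open>t = 1\<close> reads
  \<open>q x + q y \<le> q (x + y)\<close>.\<close>
lemma minimal_sublinear_linear: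
  assumes q: "sublinear q" and min: "\<And>r. sublinear r \<Longrightarrow> r \<le> q \<Longrightarrow> r = q"
  shows "linear q"
proof (rule linearI)
  have add: "q (x + y) = q x + q y" for x y
  proof -
    have "lower_along q y = q"
      by (rule min) (auto simp: le_fun_def intro: sublinear_lower_along lower_along_le_self q)
    then have "q x \<le> q (x + y) - q y" using lower_along_le[OF q, of 1 y x] by simp
    with sublinear_add[OF q, of x y] show ?thesis by simp
  qed
  then show "q (x + y) = q x + q y" for x y .
  have neg: "q (- x) = - q x" for x using add[of x "- x"] sublinear_zero[OF q] by simp
  show "q (r *\<^sub>R x) = r *\<^sub>R q x" for r x
  proof (cases "0 \<le> r")
    case True
    then show ?thesis using sublinear_scale[OF q] by simp
  next
    case False
    then have "q ((- r) *\<^sub>R x) = - r * q x" by (intro sublinear_scale q) simp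
    then show ?thesis using neg[of "r *\<^sub>R x"] by simp
  qed
qed

text \<open>The Hahn-Banach theorem: by Zorn's lemma there is a minimal sublinear functional below \<open>p\<close>, and
  it is linear. The pointwise infimum of a chain is finite since \<open>q x \<ge> - p (- x)\<close> for
  every sublinear \<open>q \<le> p\<close>.\<close>
lemma linear_below_sublinear:
  assumes p: "sublinear p"
  shows "\<exists>g. linear g \<and> (\<forall>x. g x \<le> p x)"
proof -
  define A where "A = {q. sublinear q \<and> q \<le> p}"
  have "\<exists>m\<in>A. \<forall>a\<in>A. m \<ge> a \<longrightarrow> a = m"
  proof (rule predicate_Zorn)
    show "partial_order_on A (relation_of (\<ge>) A)"
      by (auto simp: partial_order_on_def preorder_on_def relation_of_def refl_on_def
          trans_def antisym_def)
  next
    fix C assume C: "C \<in> Chains (relation_of (\<ge>) A)"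
    have CA: "q \<in> A" if "q \<in> C" for q
      using that C by (auto simp: Chains_def relation_of_def)
    show "\<exists>u\<in>A. \<forall>a\<in>C. a \<ge> u"
    proof (cases "C = {}")
      case True
      then show ?thesis using p by (auto simp: A_def)
    next
      case False
      define u where "u x = (INF q\<in>C. q x)" for x
      have below: "u x \<le> q x" if "q \<in> C" for q x
        unfolding u_def
      proof (rule cINF_lower[OF _ that])
        have "- p (- x) \<le> q x" if "q \<in> C" for q
          using CA[OF that] sublinear_ge[of q x] le_funD[of q p "- x"] by (simp add: A_def)
        then show "bdd_below ((\<lambda>q. q x) ` C)" by (rule bdd_belowI2)
      qed
      have greatest: "c \<le> u x" if "\<And>q. q \<in> C \<Longrightarrow> c \<le> q x" for c x
        unfolding u_def by (rule cINF_greatest) (use False that in auto)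
      have "sublinear u"
        unfolding sublinear_def
      proof (intro conjI allI impI)
        fix x y
        have *: "u (x + y) \<le> q x + r y" if "q \<in> C" "r \<in> C" for q r
        proof -
          \<comment> \<open>The smaller of the two chain members bounds both summands.\<close>
          have "q \<le> r \<or> r \<le> q" using C that unfolding Chains_def relation_of_def by blast
          then have "\<exists>s\<in>C. s x \<le> q x \<and> s y \<le> r y"
            using that by (meson le_funD order_refl)
          then obtain s where "s \<in> C" "s x \<le> q x" "s y \<le> r y" by blast
          then show ?thesis
            using below[of s "x + y"] CA[of s] sublinear_add[of s x y] by (fastforce simp: A_def)
        qed
        have "u (x + y) - r y \<le> u x" if "r \<in> C" for r
          by (rule greatest) (use *[OF _ that] in \<open>simp add: algebra_simps\<close>)
        then have "u (x + y) - u x \<le> u y" by (intro greatest) (simp add: algebra_simps)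
        then show "u (x + y) \<le> u x + u y" by simp
      next
        fix t :: real and x assume t: "0 < t"
        have "u (t *\<^sub>R x) / t \<le> u x"
        proof (rule greatest)
          fix q assume "q \<in> C"
          then show "u (t *\<^sub>R x) / t \<le> q x"
            using below[of q "t *\<^sub>R x"] CA[of q] t sublinear_scale[of q t x]
            by (simp add: A_def field_simps)
        qed
        then show "u (t *\<^sub>R x) \<le> t * u x" using t by (simp add: field_simps)
      qed
      moreover have "u \<le> p"
      proof (rule le_funI)
        fix x
        obtain q where q: "q \<in> C" using False by blast
        show "u x \<le> p x" using below[OF q, of x] CA[OF q] le_funD[of q p x] by (simp add: A_def)
      qed
      ultimately show ?thesis using below by (auto simp: A_def le_fun_def)
    qed
  qed
  then obtain g where g: "g \<in> A" and min: "\<And>r. r \<in> A \<Longrightarrow> r \<le> g \<Longrightarrow> r = g" by blast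
  have "linear g"
    by (rule minimal_sublinear_linear) (use g min in \<open>auto simp: A_def intro: order_trans\<close>)
  then show ?thesis using g by (auto simp: A_def le_fun_def)
qed

text \<open>Starting Zorn's lemma below \<open>lower_along norm u\<close> instead of below the norm forces
  \<open>g (- u) \<le> - \<parallel>u\<parallel>\<close>.\<close>
lemma norming_functional:
  fixes u :: "'a::real_normed_vector"
  shows "\<exists>g. linear g \<and> (\<forall>x. g x \<le> norm x) \<and> g u = norm u"
proof -
  have p: "sublinear (norm :: 'a \<Rightarrow> real)" by (auto simp: sublinear_def norm_triangle_ineq)
  obtain g where g: "linear g" "\<And>x. g x \<le> lower_along norm u x"
    using linear_below_sublinear[OF sublinear_lower_along[OF p]] by blast
  have le: "g x \<le> norm x" for x using g(2) lower_along_le_self[OF p] by (rule order_trans)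
  have "g (- u) \<le> - norm u" using g(2)[of "- u"] lower_along_le[OF p, of 1 u "- u"] by simp
  then have "norm u \<le> g u" using g(1) by (simp add: linear_neg)
  then have "g u = norm u" using le[of u] by simp
  with g(1) le show ?thesis by blast
qed

lemma clinear_iff:
  "clinear f \<longleftrightarrow> (\<forall>x y. f (x + y) = f x + f y) \<and> (\<forall>c x. f (c *\<^sub>C x) = c *\<^sub>C f x)"
  by (simp add: Vector_Spaces.linear_iff complex_vector.vector_space_axioms)

text \<open>A real functional \<open>g\<close> is the real part of the complex functional \<open>g x - \<i> g (\<i> x)\<close>.\<close>
lemma dual_space_separates:
  fixes u :: "'a::complex_normed_vector"
  assumes "u \<noteq> 0"
  shows "\<exists>f\<in>dual_space. blinfun_apply f u \<noteq> 0"
proof -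
  obtain g :: "'a \<Rightarrow> real" where g: "linear g" and le: "\<And>x. g x \<le> norm x" and gu: "g u = norm u"
    using norming_functional[of u] by blast
  have abs_le: "\<bar>g x\<bar> \<le> norm x" for x
    using le[of x] le[of "- x"] g by (simp add: linear_neg)
  define F where "F x = Complex (g x) (- g (\<i> *\<^sub>C x))" for x
  have Fadd: "F (x + y) = F x + F y" for x y
    using g by (simp add: F_def complex_eq_iff scaleC_add_right linear_add)
  have FC: "F (c *\<^sub>C x) = c * F x" for c x
  proof -
    have "c *\<^sub>C x = Re c *\<^sub>R x + Im c *\<^sub>R (\<i> *\<^sub>C x)"
      unfolding scaleR_scaleC scaleC_scaleC scaleC_add_left[symmetric]
      by (simp add: complex_eq_iff mult.commute flip: complex_eq)
    moreover have "\<i> *\<^sub>C c *\<^sub>C x = Re c *\<^sub>R (\<i> *\<^sub>C x) + (- Im c) *\<^sub>R x"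
      unfolding scaleR_scaleC scaleC_scaleC scaleC_add_left[symmetric]
      by (rule arg_cong[of _ _ "\<lambda>c. c *\<^sub>C x"]) (simp add: complex_eq_iff)
    ultimately show ?thesis using g
      by (simp add: F_def complex_eq_iff linear_add linear_scale linear_neg linear_diff)
  qed
  have bound: "cmod (F x) \<le> norm x * 2" for x
    using cmod_le[of "F x"] abs_le[of x] abs_le[of "\<i> *\<^sub>C x"]
    by (simp add: F_def norm_scaleC)
  have "bounded_linear F"
    by (rule bounded_linear_intro[OF Fadd _ bound]) (simp add: scaleR_scaleC FC scaleC_complex_def)
  then have [simp]: "blinfun_apply (Blinfun F) = F" by (rule bounded_linear_Blinfun_apply)
  have "Blinfun F \<in> dual_space"
    using Fadd FC by (simp add: dual_space_def clinear_iff scaleC_complex_def)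
  moreover have "Re (F u) \<noteq> 0" using gu assms by (simp add: F_def)
  then have "Blinfun F u \<noteq> 0" by auto
  ultimately show ?thesis by blast
qed

lemma dual_space_clinear:
  "f \<in> dual_space \<Longrightarrow> clinear (blinfun_apply f)"
  by (simp add: dual_space_def)

text \<open>Choosing \<open>f\<close> first, then \<open>b\<close> in its kernel,
  then \<open>g\<close> with \<open>g b \<noteq> 0\<close>, makes the matrix of values triangular, and subtracting a multiple of
  \<open>b\<close> from \<open>u\<close> makes it diagonal.\<close>
lemma biorthogonal_pair:
  fixes u w :: "'a::complex_normed_vector"
  assumes u: "u \<noteq> 0" and w: "\<And>c. w \<noteq> c *\<^sub>C u"
  shows "\<exists>f\<in>dual_space. \<exists>g\<in>dual_space. \<exists>a b :: 'a.
    blinfun_apply f a = 1 \<and> blinfun_apply f b = 0 \<and>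
    blinfun_apply g a = 0 \<and> blinfun_apply g b = 1"
proof -
  obtain f :: "'a \<Rightarrow>\<^sub>L complex" where f: "f \<in> dual_space" "f u \<noteq> 0"
    using dual_space_separates[OF u] by blast
  have fC: "f (c *\<^sub>C x) = c * f x" for c x
    using dual_space_clinear[OF f(1)] by (simp add: clinear_iff scaleC_complex_def)
  define v where "v = w - (f w / f u) *\<^sub>C u"
  have "v \<noteq> 0" using w by (simp add: v_def)
  then obtain g :: "'a \<Rightarrow>\<^sub>L complex" where g: "g \<in> dual_space" "g v \<noteq> 0"
    using dual_space_separates by blast
  have gC: "g (c *\<^sub>C x) = c * g x" for c x
    using dual_space_clinear[OF g(1)] by (simp add: clinear_iff scaleC_complex_def)
  define b where "b = inverse (g v) *\<^sub>C v"
  have b: "f b = 0" "g b = 1"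
    using f g by (simp_all add: b_def v_def fC gC blinfun.diff_right)
  define a where "a = inverse (f u) *\<^sub>C (u - g u *\<^sub>C b)"
  have "f a = 1" "g a = 0"
    using f b by (simp_all add: a_def fC gC blinfun.diff_right)
  with b f g show ?thesis by blast
qed

section \<open>Baire category and supercyclicity in a subspace with its own norm\<close>

context complete_norm_on
begin

lemma closed_under:
  "0 \<in> Y" "x \<in> Y \<Longrightarrow> y \<in> Y \<Longrightarrow> x + y \<in> Y" "x \<in> Y \<Longrightarrow> y \<in> Y \<Longrightarrow> x - y \<in> Y"
  "x \<in> Y \<Longrightarrow> c *\<^sub>C x \<in> Y"
  using subspace by (auto intro: complex_vector.subspace_0 complex_vector.subspace_add
      complex_vector.subspace_diff complex_vector.subspace_scale)

lemma norm_zero: "N 0 = 0"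
  using eq_zero_iff[OF closed_under(1)] by simp

lemma norm_diff_commute:
  assumes "x \<in> Y" "y \<in> Y"
  shows "N (x - y) = N (y - x)"
  using homogeneous[of "y - x" "-1"] assms by (simp add: closed_under)

lemma diff_triangle:
  assumes "x \<in> Y" "y \<in> Y" "z \<in> Y"
  shows "N (x - z) \<le> N (x - y) + N (y - z)"
  using triangle[of "x - y" "y - z"] assms by (simp add: closed_under)

text \<open>A \<open>Metric_space\<close> needs a distance that is nonnegative and symmetric on the whole type,
  whereas \<open>N\<close> is arbitrary outside \<open>Y\<close>; hence the default value.\<close>
lemma Metric_space: "Metric_space Y (\<lambda>x y. if x \<in> Y \<and> y \<in> Y then N (x - y) else 0)"
  by unfold_locales
    (auto simp: nonneg closed_under eq_zero_iff norm_diff_commute diff_triangle)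

lemma mcomplete:
  "Metric_space.mcomplete Y (\<lambda>x y. if x \<in> Y \<and> y \<in> Y then N (x - y) else 0)"
proof -
  interpret M: Metric_space Y "\<lambda>x y. if x \<in> Y \<and> y \<in> Y then N (x - y) else 0"
    by (rule Metric_space)
  show ?thesis
    unfolding M.mcomplete_def
  proof (intro allI impI)
    fix u assume u: "M.MCauchy u"
    then have uY: "u n \<in> Y" for n by (auto simp: M.MCauchy_def)
    then have "\<exists>l\<in>Y. (\<lambda>n. N (u n - l)) \<longlonglongrightarrow> 0"
      using u by (intro complete) (auto simp: M.MCauchy_def)
    then show "\<exists>l. limitin M.mtopology u l sequentially"
      using uY by (auto simp: M.limitin_metric_dist_null)
  qed
qed

lemma Baire:
  assumes "countable I"
    and G: "\<And>i. i \<in> I \<Longrightarrow> G i \<subseteq> Y"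
    and op: "\<And>i x. i \<in> I \<Longrightarrow> x \<in> G i \<Longrightarrow> \<exists>r>0. \<forall>z\<in>Y. N (z - x) < r \<longrightarrow> z \<in> G i"
    and dense: "\<And>i x e. i \<in> I \<Longrightarrow> x \<in> Y \<Longrightarrow> 0 < e \<Longrightarrow> \<exists>z\<in>G i. N (z - x) < e"
  shows "\<exists>x\<in>Y. \<forall>i\<in>I. x \<in> G i"
proof -
  interpret M: Metric_space Y "\<lambda>x y. if x \<in> Y \<and> y \<in> Y then N (x - y) else 0"
    by (rule Metric_space)
  have "M.mtopology closure_of \<Inter> (G ` I) = Y"
  proof (rule M.metric_Baire_category[OF mcomplete])
    show "countable (G ` I)" using assms(1) by simp
    fix T assume "T \<in> G ` I"
    then obtain i where i: "i \<in> I" "T = G i" by blast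
    have "openin M.mtopology (G i)"
      unfolding M.openin_mtopology
    proof (intro conjI allI impI G i)
      fix x assume x: "x \<in> G i"
      then obtain r where r: "r > 0" "\<And>z. z \<in> Y \<Longrightarrow> N (z - x) < r \<Longrightarrow> z \<in> G i"
        using op[OF i(1) x] by blast
      have "M.mball x r \<subseteq> G i"
        using r(2) norm_diff_commute by (auto simp: M.mball_def split: if_splits)
      then show "\<exists>r>0. M.mball x r \<subseteq> G i" using r(1) by blast
    qed
    moreover have "M.mtopology closure_of (G i) = Y"
      unfolding M.metric_closure_of M.mball_def
    proof (intro equalityI subsetI CollectI conjI allI impI)
      fix x and r :: real assume x: "x \<in> Y" and "0 < r"
      then obtain z where z: "z \<in> G i" "N (z - x) < r" using dense[OF i(1)] by blast
      then show "\<exists>y\<in>G i. y \<in> {y. x \<in> Y \<and> y \<in> Y \<and>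
          (if x \<in> Y \<and> y \<in> Y then N (x - y) else 0) < r}"
        using x G[OF i(1)] norm_diff_commute by (intro bexI[of _ z]) auto
    qed auto
    ultimately show "openin M.mtopology T \<and> M.mtopology closure_of T = Y" using i by simp
  qed
  then have "0 \<in> M.mtopology closure_of \<Inter> (G ` I)" using closed_under(1) by simp
  then obtain x where "x \<in> \<Inter> (G ` I)" "x \<in> Y"
    unfolding M.metric_closure_of M.mball_def using zero_less_one by blast
  then show ?thesis by blast
qed

end

text \<open>Smallness of the product alone, which is all that the supercyclicity criterion provides, makes
  both factors small after rescaling.\<close>
lemma scalar_balancing:
  fixes a b e :: real
  assumes "0 \<le> a" "0 \<le> b" "0 < e" "a * b < e\<^sup>2"
  shows "\<exists>r>0. b < e * r \<and> r * a < e"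
proof (cases "a = 0")
  case True
  show ?thesis using assms True by (intro exI[of _ "b / e + 1"]) (auto simp: field_simps add_nonneg_pos)
next
  case False
  then have a: "a > 0" using assms by simp
  have "b / e < e / a" using assms a by (simp add: field_simps power2_eq_square)
  then obtain r where "b / e < r" "r < e / a" using dense by blast
  moreover from this have "0 < r" using assms by (meson divide_nonneg_pos le_less_trans)
  ultimately show ?thesis using assms a by (intro exI[of _ r]) (auto simp: field_simps)
qed

locale bounded_operator_on = complete_norm_on Y N
  for Y :: "'v::complex_vector set" and N :: "'v \<Rightarrow> real" +
  fixes L :: "'v \<Rightarrow> 'v" and K :: real
  assumes maps: "x \<in> Y \<Longrightarrow> L x \<in> Y"
    and add: "x \<in> Y \<Longrightarrow> y \<in> Y \<Longrightarrow> L (x + y) = L x + L y"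
    and scale: "x \<in> Y \<Longrightarrow> L (c *\<^sub>C x) = c *\<^sub>C L x"
    and bound_nonneg: "0 \<le> K"
    and bound: "x \<in> Y \<Longrightarrow> N (L x) \<le> K * N x"
begin

lemma iterate_operator: "bounded_operator_on Y N (L ^^ n) (K ^ n)"
proof (induction n)
  case 0
  show ?case by unfold_locales auto
next
  case (Suc n)
  interpret I: bounded_operator_on Y N "L ^^ n" "K ^ n" by (rule Suc)
  show ?case
  proof unfold_locales
    fix x assume x: "x \<in> Y"
    have "N (L ((L ^^ n) x)) \<le> K * N ((L ^^ n) x)" by (intro bound I.maps x)
    also have "\<dots> \<le> K * (K ^ n * N x)" by (intro mult_left_mono I.bound x bound_nonneg)
    finally show "N ((L ^^ Suc n) x) \<le> K ^ Suc n * N x" by (simp add: mult.assoc)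
  qed (auto simp: maps add scale I.maps I.add I.scale bound_nonneg)
qed

lemma diff: "x \<in> Y \<Longrightarrow> y \<in> Y \<Longrightarrow> L (x - y) = L x - L y"
  using add[of "x - y" y] by (simp add: closed_under algebra_simps)

text \<open>The vectors whose projective orbit comes within \<open>1 / (m + 1)\<close> of a given \<open>d\<close> form an open set,
  which is dense by transitivity. Letting \<open>d\<close> range over a countable dense set, a point
  common to all these sets is supercyclic.\<close>
lemma transitive_imp_supercyclic:
  assumes sep: "separable_wrt Y N"
    and trans: "\<And>A B e. A \<in> Y \<Longrightarrow> B \<in> Y \<Longrightarrow> 0 < e \<Longrightarrow>
      \<exists>Z\<in>Y. \<exists>\<alpha> n. N (Z - A) < e \<and> N (\<alpha> *\<^sub>C (L ^^ n) Z - B) < e"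
  shows "supercyclic Y N L"
proof -
  obtain D where D: "countable D" "D \<subseteq> Y"
    "\<And>y e. y \<in> Y \<Longrightarrow> 0 < e \<Longrightarrow> \<exists>d\<in>D. N (y - d) < e"
    using sep unfolding separable_wrt_def dense_wrt_def by blast
  have LnY: "(L ^^ n) x \<in> Y" if "x \<in> Y" for n x
    using bounded_operator_on.maps[OF iterate_operator that] .
  define G where "G = (\<lambda>(d, m :: nat). {x \<in> Y. \<exists>\<alpha> n. N (\<alpha> *\<^sub>C (L ^^ n) x - d) < inverse (Suc m)})"
  have "\<exists>x\<in>Y. \<forall>i\<in>D \<times> UNIV. x \<in> G i"
  proof (rule Baire)
    show "countable (D \<times> (UNIV :: nat set))" using D(1) by simp
    show "G i \<subseteq> Y" for i by (cases i) (auto simp: G_def)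
  next
    fix i x assume i: "i \<in> D \<times> (UNIV :: nat set)" and x: "x \<in> G i"
    obtain d m where dm: "i = (d, m)" by (cases i)
    then have d: "d \<in> Y" using D(2) i by auto
    obtain \<alpha> n where xY: "x \<in> Y" and lt: "N (\<alpha> *\<^sub>C (L ^^ n) x - d) < inverse (Suc m)"
      using x by (auto simp: G_def dm)
    interpret I: bounded_operator_on Y N "L ^^ n" "K ^ n" by (rule iterate_operator)
    \<comment> \<open>Within distance \<open>gap / C\<close> of \<open>x\<close> the image moves by less than \<open>gap\<close>.\<close>
    define gap where "gap = inverse (Suc m) - N (\<alpha> *\<^sub>C (L ^^ n) x - d)"
    define C where "C = cmod \<alpha> * K ^ n + 1"
    have gap: "gap > 0" using lt by (simp add: gap_def)
    have C: "C > 0" using I.bound_nonneg by (simp add: C_def add_nonneg_pos)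
    have "z \<in> G i" if z: "z \<in> Y" and close: "N (z - x) < gap / C" for z
    proof -
      have "N (\<alpha> *\<^sub>C (L ^^ n) z - \<alpha> *\<^sub>C (L ^^ n) x) = N (\<alpha> *\<^sub>C (L ^^ n) (z - x))"
        by (simp add: I.diff z xY complex_vector.scale_right_diff_distrib)
      also have "\<dots> = cmod \<alpha> * N ((L ^^ n) (z - x))"
        by (intro homogeneous LnY closed_under z xY)
      also have "\<dots> \<le> cmod \<alpha> * (K ^ n * N (z - x))"
        by (intro mult_left_mono I.bound closed_under z xY) simp
      also have "\<dots> \<le> C * N (z - x)"
        using nonneg[of "z - x"] z xY by (simp add: C_def algebra_simps closed_under)
      also have "\<dots> < gap" using close C by (simp add: field_simps)
      finally have "N (\<alpha> *\<^sub>C (L ^^ n) z - \<alpha> *\<^sub>C (L ^^ n) x) < gap" .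
      then have "N (\<alpha> *\<^sub>C (L ^^ n) z - d) < inverse (Suc m)"
        using diff_triangle[of "\<alpha> *\<^sub>C (L ^^ n) z" "\<alpha> *\<^sub>C (L ^^ n) x" d] z xY d
        by (simp add: gap_def closed_under LnY)
      then show ?thesis using z by (auto simp: G_def dm)
    qed
    then show "\<exists>r>0. \<forall>z\<in>Y. N (z - x) < r \<longrightarrow> z \<in> G i"
      using gap C by (intro exI[of _ "gap / C"]) auto
  next
    fix i x and e :: real assume i: "i \<in> D \<times> (UNIV :: nat set)" and x: "x \<in> Y" and e: "0 < e"
    obtain d m where dm: "i = (d, m)" by (cases i)
    then have d: "d \<in> Y" using D(2) i by auto
    obtain Z \<alpha> n where "Z \<in> Y" "N (Z - x) < min e (inverse (Suc m))"
      "N (\<alpha> *\<^sub>C (L ^^ n) Z - d) < min e (inverse (Suc m))"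
      using trans[OF x d, of "min e (inverse (Suc m))"] e by auto
    then show "\<exists>z\<in>G i. N (z - x) < e"
      by (intro bexI[of _ Z]) (auto simp: G_def dm)
  qed
  then obtain x where x: "x \<in> Y" and xG: "\<And>d m. d \<in> D \<Longrightarrow> x \<in> G (d, m)" by blast
  have "dense_wrt Y N {\<alpha> *\<^sub>C (L ^^ n) x | \<alpha> n. True}"
    unfolding dense_wrt_def
  proof (intro conjI ballI allI impI)
    show "{\<alpha> *\<^sub>C (L ^^ n) x |\<alpha> n. True} \<subseteq> Y" using x by (auto intro: closed_under LnY)
    fix y and e :: real assume y: "y \<in> Y" and e: "0 < e"
    obtain d where d: "d \<in> D" "N (y - d) < e / 2" using D(3)[OF y, of "e / 2"] e by auto
    obtain m where m: "inverse (Suc m) < e / 2" using reals_Archimedean[of "e / 2"] e by auto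
    obtain \<alpha> n where "N (\<alpha> *\<^sub>C (L ^^ n) x - d) < inverse (Suc m)"
      using xG[OF d(1), of m] by (auto simp: G_def)
    moreover have dY: "d \<in> Y" using d D(2) by blast
    ultimately have "N (y - \<alpha> *\<^sub>C (L ^^ n) x) < e"
      using diff_triangle[of y d "\<alpha> *\<^sub>C (L ^^ n) x"] norm_diff_commute[of d "\<alpha> *\<^sub>C (L ^^ n) x"]
        x y d m by (simp add: closed_under LnY)
    then show "\<exists>d\<in>{\<alpha> *\<^sub>C (L ^^ n) x |\<alpha> n. True}. N (y - d) < e" by blast
  qed
  then show ?thesis using x unfolding supercyclic_def by blast
qed

text \<open>The approximate preimages are given as one sequence \<open>C\<close> for each \<open>B\<close> rather than as maps
  \<open>S\<^bsub>n k\<^esub>\<close>: finite sums of rank one operators have no canonical representation, and the numbers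
  \<open>n k\<close> may repeat.\<close>
lemma criterion_imp_transitive:
  assumes D1: "dense_wrt Y N D1" and D2: "dense_wrt Y N D2"
    and crit: "\<And>B. B \<in> D2 \<Longrightarrow> \<exists>C. (\<forall>k. C k \<in> Y) \<and>
      (\<lambda>k. N ((L ^^ n k) (C k) - B)) \<longlonglongrightarrow> 0 \<and>
      (\<forall>A\<in>D1. (\<lambda>k. N ((L ^^ n k) A) * N (C k)) \<longlonglongrightarrow> 0)"
    and A: "A \<in> Y" and B: "B \<in> Y" and e: "0 < e"
  shows "\<exists>Z\<in>Y. \<exists>\<alpha> m. N (Z - A) < e \<and> N (\<alpha> *\<^sub>C (L ^^ m) Z - B) < e"
proof -
  obtain A' where A': "A' \<in> D1" "N (A - A') < e / 2"
    using D1 A e unfolding dense_wrt_def by (meson half_gt_zero)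
  obtain B' where B': "B' \<in> D2" "N (B - B') < e / 3"
    using D2 B e unfolding dense_wrt_def by (meson zero_less_divide_iff zero_less_numeral)
  have Y: "A' \<in> Y" "B' \<in> Y" using A' B' D1 D2 by (auto simp: dense_wrt_def)
  obtain C where C: "\<And>k. C k \<in> Y" "(\<lambda>k. N ((L ^^ n k) (C k) - B')) \<longlonglongrightarrow> 0"
    "(\<lambda>k. N ((L ^^ n k) A') * N (C k)) \<longlonglongrightarrow> 0"
    using crit[OF B'(1)] A'(1) by blast
  have "\<forall>\<^sub>F k in sequentially. N ((L ^^ n k) (C k) - B') < e / 3 \<and>
      N ((L ^^ n k) A') * N (C k) < (e / 3)\<^sup>2"
    using C(2,3) e by (intro eventually_conj order_tendstoD(2)) auto
  then obtain k where k: "N ((L ^^ n k) (C k) - B') < e / 3"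
      "N ((L ^^ n k) A') * N (C k) < (e / 3)\<^sup>2"
    by (auto simp: eventually_sequentially)
  interpret I: bounded_operator_on Y N "L ^^ n k" "K ^ n k" by (rule iterate_operator)
  obtain r where r: "r > 0" "N (C k) < e / 3 * r" "r * N ((L ^^ n k) A') < e / 3"
    using scalar_balancing[of "N ((L ^^ n k) A')" "N (C k)" "e / 3"] k e
    by (auto simp: nonneg C I.maps Y)
  define Z where "Z = A' + complex_of_real (1 / r) *\<^sub>C C k"
  have Z: "Z \<in> Y" by (simp add: Z_def closed_under Y C)
  have "N (Z - A') = N (C k) / r"
    using r by (simp add: Z_def homogeneous[OF C(1)] norm_divide)
  also have "\<dots> < e / 3" using r by (simp add: field_simps)
  finally have "N (Z - A) < e"
    using diff_triangle[OF Z Y(1) A] norm_diff_commute[OF A Y(1)] A'(2) e by simp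
  moreover
  have "complex_of_real r *\<^sub>C (L ^^ n k) Z
      = complex_of_real r *\<^sub>C (L ^^ n k) A' + (L ^^ n k) (C k)"
    using r by (simp add: Z_def I.add I.scale Y C closed_under scaleC_add_right scaleC_scaleC
        scaleC_one flip: of_real_mult)
  then have "N (complex_of_real r *\<^sub>C (L ^^ n k) Z - B') \<le>
      N (complex_of_real r *\<^sub>C (L ^^ n k) A') + N ((L ^^ n k) (C k) - B')"
    using triangle[of "complex_of_real r *\<^sub>C (L ^^ n k) A'" "(L ^^ n k) (C k) - B'"]
    by (simp add: closed_under I.maps Y C algebra_simps)
  then have "N (complex_of_real r *\<^sub>C (L ^^ n k) Z - B') < 2 * (e / 3)"
    using k r by (simp add: homogeneous I.maps Y)
  then have "N (complex_of_real r *\<^sub>C (L ^^ n k) Z - B) < e"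
    using diff_triangle[of "complex_of_real r *\<^sub>C (L ^^ n k) Z" B' B] norm_diff_commute[OF B Y(2)]
      B'(2) by (simp add: closed_under I.maps Y B Z)
  ultimately show ?thesis using Z by blast
qed

end

section \<open>Transitivity of left multiplication on a Banach ideal\<close>

text \<open>The additive submonoid generated by \<open>S\<close>. It takes the place of the linear span because a dense
  set \<open>D\<close> of vectors need not be closed under scalar multiples.\<close>
inductive_set additive_closure :: "'v::comm_monoid_add set \<Rightarrow> 'v set" for S where
  zero: "0 \<in> additive_closure S"
| add: "a \<in> S \<Longrightarrow> b \<in> additive_closure S \<Longrightarrow> a + b \<in> additive_closure S"

lemma rank_one_scaleC: "c *\<^sub>C (x \<otimes>\<^sub>r f) = (c *\<^sub>C x) \<otimes>\<^sub>r f"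
  by (rule blinfun_eqI)
    (simp add: scaleC_blinfun.rep_eq rank_one.rep_eq scaleC_scaleC mult.commute)

lemma rank_one_diff: "x \<otimes>\<^sub>r f - y \<otimes>\<^sub>r f = (x - y) \<otimes>\<^sub>r f"
  by (rule blinfun_eqI)
    (simp add: blinfun.diff_left rank_one.rep_eq complex_vector.scale_right_diff_distrib)

lemma left_mult_power_rank_one:
  assumes "T \<in> bounded_operators"
  shows "(left_mult T ^^ n) (x \<otimes>\<^sub>r f) = ((blinfun_apply T ^^ n) x) \<otimes>\<^sub>r f"
proof (induction n)
  case (Suc n)
  have "left_mult T (y \<otimes>\<^sub>r f) = T y \<otimes>\<^sub>r f" for y
    using assms by (intro blinfun_eqI)
      (simp add: left_mult_def rank_one.rep_eq bounded_operators_def clinear_iff)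
  then show ?case using Suc by simp
qed simp

lemma left_mult_power_apply: "blinfun_apply ((left_mult T ^^ n) A) z = (blinfun_apply T ^^ n) (A z)"
  by (induction n) (simp_all add: left_mult_def)

context banach_ideal
begin

lemma left_mult_bounded_operator_on:
  assumes T: "T \<in> bounded_operators"
  shows "bounded_operator_on J N (left_mult T) (norm T)"
proof unfold_locales
  have id: "id_blinfun \<in> (bounded_operators :: ('a \<Rightarrow>\<^sub>L 'a) set)"
    by (simp add: bounded_operators_def clinear_iff)
  fix A assume A: "A \<in> J"
  have eq: "left_mult T A = T o\<^sub>L A o\<^sub>L id_blinfun"
    by (rule blinfun_eqI) (simp add: left_mult_def)
  show "left_mult T A \<in> J" unfolding eq by (rule ideal[OF A T id])
  have "N (left_mult T A) \<le> norm T * N A * norm (id_blinfun :: 'a \<Rightarrow>\<^sub>L 'a)"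
    unfolding eq by (rule ideal_norm[OF A T id])
  also have "\<dots> \<le> norm T * N A * 1"
    by (intro mult_left_mono norm_blinfun_id_le mult_nonneg_nonneg nonneg A) simp
  finally show "N (left_mult T A) \<le> norm T * N A" by simp
  show "left_mult T (c *\<^sub>C A) = c *\<^sub>C left_mult T A" for c
    using T by (intro blinfun_eqI)
      (simp add: left_mult_def scaleC_blinfun.rep_eq bounded_operators_def clinear_iff)
  show "left_mult T (A + B) = left_mult T A + left_mult T B" for B
    by (simp add: left_mult_def bounded_bilinear.add_right[OF bounded_bilinear_blinfun_compose])
qed simp

end

context admissible_banach_ideal
begin

text \<open>A scalar in front of a rank one operator is absorbed into its vector, and since
  \<open>\<parallel>x \<otimes> f - y \<otimes> f\<parallel> = \<parallel>x - y\<parallel> \<parallel>f\<parallel>\<close> the vector may be replaced by a nearby one of \<open>D\<close>.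
  So the sums come arbitrarily close to every finite rank operator.\<close>
lemma dense_additive_closure_rank_one:
  assumes D: "dense_wrt UNIV norm D"
  shows "dense_wrt J N (additive_closure {x \<otimes>\<^sub>r f | x f. x \<in> D \<and> f \<in> dual_space})"
    (is "dense_wrt J N (additive_closure ?S)")
proof -
  have SJ: "?S \<subseteq> J" using rank_one_in by blast
  have AJ: "A \<in> J" if "A \<in> additive_closure ?S" for A
    using that
  proof induction
    case zero
    show ?case by (rule closed_under(1))
  next
    case (add a b)
    show ?case by (rule closed_under(2)[OF subsetD[OF SJ add(1)] add.IH])
  qed
  define close where
    "close A \<longleftrightarrow> A \<in> J \<and> (\<forall>e>0. \<exists>B\<in>additive_closure ?S. N (A - B) < e)" for A
  have close: "close A" if "A \<in> finite_rank_operators" for A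
    using that unfolding finite_rank_operators_def
  proof (induction rule: complex_vector.span_induct_alt)
    case base
    have "\<exists>B\<in>additive_closure ?S. N (0 - B) < e" if "0 < e" for e
      by (rule bexI[OF _ additive_closure.zero]) (simp add: norm_zero that)
    then show ?case unfolding close_def using closed_under(1) by blast
  next
    case (step c R A)
    then obtain x f where R: "R = x \<otimes>\<^sub>r f" and f: "f \<in> dual_space" by blast
    have AinJ: "A \<in> J" using step by (simp add: close_def)
    have "\<exists>B\<in>additive_closure ?S. N (c *\<^sub>C R + A - B) < e" if e: "0 < e" for e
    proof -
      obtain B where B: "B \<in> additive_closure ?S" "N (A - B) < e / 2"
        using step e unfolding close_def by (meson half_gt_zero)
      have pos: "0 < e / 2 / (norm f + 1)" using e by (simp add: add_nonneg_pos)
      obtain y where y: "y \<in> D" "norm (c *\<^sub>C x - y) < e / 2 / (norm f + 1)"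
        using D pos unfolding dense_wrt_def by blast
      have "N (c *\<^sub>C R - y \<otimes>\<^sub>r f) = norm (c *\<^sub>C x - y) * norm f"
        by (simp add: R rank_one_scaleC rank_one_diff rank_one_norm f)
      also have "\<dots> \<le> norm (c *\<^sub>C x - y) * (norm f + 1)" by (intro mult_left_mono) auto
      also have "\<dots> < e / 2" using pos_less_divide_eq[THEN iffD1, OF _ y(2)]
        by (simp add: add_nonneg_pos)
      finally have "N (c *\<^sub>C R - y \<otimes>\<^sub>r f) < e / 2" .
      moreover have "N ((c *\<^sub>C R - y \<otimes>\<^sub>r f) + (A - B)) \<le> N (c *\<^sub>C R - y \<otimes>\<^sub>r f) + N (A - B)"
        by (intro triangle closed_under AinJ AJ[OF B(1)]) (simp_all add: R rank_one_in f)
      moreover have "(c *\<^sub>C R - y \<otimes>\<^sub>r f) + (A - B) = c *\<^sub>C R + A - (y \<otimes>\<^sub>r f + B)" by simp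
      moreover have "y \<otimes>\<^sub>r f + B \<in> additive_closure ?S"
        by (rule additive_closure.add[OF _ B(1)]) (use y(1) f in blast)
      ultimately show ?thesis
        using B(2) by (intro bexI[of _ "y \<otimes>\<^sub>r f + B"]) simp_all
    qed
    moreover have "c *\<^sub>C R + A \<in> J"
      by (intro closed_under AinJ) (simp add: R rank_one_in f)
    ultimately show ?case by (simp add: close_def)
  qed
  show ?thesis
    unfolding dense_wrt_def
  proof (intro conjI ballI allI impI subsetI AJ)
    fix A and e :: real assume A: "A \<in> J" and e: "0 < e"
    obtain F where F: "F \<in> finite_rank_operators" "N (A - F) < e / 2"
      using finite_rank_dense A e unfolding dense_wrt_def by (meson half_gt_zero)
    obtain B where B: "B \<in> additive_closure ?S" "N (F - B) < e / 2"
      using close[OF F(1)] e unfolding close_def by (meson half_gt_zero)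
    have "F \<in> J" using close[OF F(1)] by (simp add: close_def)
    then have "N (A - B) < e" using diff_triangle[OF A _ AJ[OF B(1)], of F] F(2) B(2) by simp
    then show "\<exists>B\<in>additive_closure ?S. N (A - B) < e" using B(1) by blast
  qed
qed

text \<open>The hypotheses of \<open>criterion_imp_transitive\<close> are stable under sums, so it suffices to check them
  on rank one operators. This is done in two steps, keeping a vector \<open>y\<close> as the second factor of the
  products while the first factor runs through the sums (\<open>smallE\<close>).\<close>
lemma criterion_imp_left_mult_supercyclic:
  assumes sep: "separable_wrt J N" and T: "T \<in> bounded_operators"
    and crit: "supercyclicity_criterion UNIV norm (blinfun_apply T)"
  shows "supercyclic J N (left_mult T)"
proof -
  interpret L: bounded_operator_on J N "left_mult T" "norm T"
    by (rule left_mult_bounded_operator_on[OF T])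
  obtain D1 D2 :: "'a set" and n :: "nat \<Rightarrow> nat" and S where
    D1: "dense_wrt UNIV norm D1" and D2: "dense_wrt UNIV norm D2"
    and small: "\<And>x y. x \<in> D1 \<Longrightarrow> y \<in> D2 \<Longrightarrow>
      (\<lambda>k. norm ((blinfun_apply T ^^ n k) x) * norm (S (n k) y)) \<longlonglongrightarrow> 0"
    and inv: "\<And>y. y \<in> D2 \<Longrightarrow> (\<lambda>k. norm ((blinfun_apply T ^^ n k) (S (n k) y) - y)) \<longlonglongrightarrow> 0"
    using crit unfolding supercyclicity_criterion_def by blast
  define E where "E D = additive_closure {x \<otimes>\<^sub>r f | x f. x \<in> D \<and> f \<in> (dual_space :: ('a \<Rightarrow>\<^sub>L complex) set)}" for D
  have E: "dense_wrt J N (E D1)" "dense_wrt J N (E D2)"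
    unfolding E_def by (intro dense_additive_closure_rank_one D1 D2)+
  have EJ: "A \<in> J" if "A \<in> E D1 \<or> A \<in> E D2" for A
    using that E by (auto simp: dense_wrt_def)
  have LnJ: "(left_mult T ^^ m) A \<in> J" if "A \<in> J" for m A
    using bounded_operator_on.maps[OF L.iterate_operator that] .
  have Lnadd: "(left_mult T ^^ m) (A + B) = (left_mult T ^^ m) A + (left_mult T ^^ m) B"
    if "A \<in> J" "B \<in> J" for m A B
    using bounded_operator_on.add[OF L.iterate_operator that] .
  have smallE: "(\<lambda>k. N ((left_mult T ^^ n k) A) * norm (S (n k) y)) \<longlonglongrightarrow> 0"
    if "A \<in> E D1" "y \<in> D2" for A y
    using that(1) unfolding E_def
  proof induction
    case zero
    have "(left_mult T ^^ m) 0 = 0" for m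
      using Lnadd[of 0 0] closed_under(1) by simp
    then show ?case by (simp add: norm_zero)
  next
    case (add R A)
    then obtain x f where R: "R = x \<otimes>\<^sub>r f" and x: "x \<in> D1" and f: "f \<in> dual_space" by blast
    have A: "A \<in> J" using add EJ unfolding E_def by blast
    have RJ: "R \<in> J" using f by (simp add: R rank_one_in)
    let ?b = "\<lambda>k. norm f * (norm ((blinfun_apply T ^^ n k) x) * norm (S (n k) y))
      + N ((left_mult T ^^ n k) A) * norm (S (n k) y)"
    have lim: "?b \<longlonglongrightarrow> norm f * 0 + 0"
      by (intro tendsto_add tendsto_mult_left small x that add.IH)
    have "N ((left_mult T ^^ n k) (R + A)) * norm (S (n k) y) \<le> ?b k" for k
    proof -
      have "N ((left_mult T ^^ n k) (R + A)) \<le> N ((left_mult T ^^ n k) R) + N ((left_mult T ^^ n k) A)"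
        unfolding Lnadd[OF RJ A] by (intro triangle LnJ RJ A)
      also have "N ((left_mult T ^^ n k) R) = norm ((blinfun_apply T ^^ n k) x) * norm f"
        by (simp add: R left_mult_power_rank_one[OF T] rank_one_norm f)
      finally show ?thesis using mult_right_mono[of _ _ "norm (S (n k) y)"]
        by (fastforce simp: algebra_simps)
    qed
    then show ?case
      using lim by (intro tendsto_sandwich[OF _ _ tendsto_const lim[simplified]])
        (auto intro!: always_eventually mult_nonneg_nonneg nonneg LnJ closed_under RJ A)
  qed
  have "\<exists>C. (\<forall>k. C k \<in> J) \<and> (\<lambda>k. N ((left_mult T ^^ n k) (C k) - B)) \<longlonglongrightarrow> 0 \<and>
      (\<forall>A\<in>E D1. (\<lambda>k. N ((left_mult T ^^ n k) A) * N (C k)) \<longlonglongrightarrow> 0)" if "B \<in> E D2" for B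
    using that unfolding E_def[of D2]
  proof induction
    case zero
    have "(left_mult T ^^ m) 0 = 0" for m
      using Lnadd[of 0 0] closed_under(1) by simp
    then show ?case by (intro exI[of _ "\<lambda>_. 0"]) (simp add: norm_zero closed_under(1))
  next
    case (add R B)
    then obtain y f where R: "R = y \<otimes>\<^sub>r f" and y: "y \<in> D2" and f: "f \<in> dual_space" by blast
    obtain C where C: "\<And>k. C k \<in> J" "(\<lambda>k. N ((left_mult T ^^ n k) (C k) - B)) \<longlonglongrightarrow> 0"
      "\<And>A. A \<in> E D1 \<Longrightarrow> (\<lambda>k. N ((left_mult T ^^ n k) A) * N (C k)) \<longlonglongrightarrow> 0"
      using add.IH by blast
    have B: "B \<in> J" using add EJ unfolding E_def by blast
    have RJ: "R \<in> J" using f by (simp add: R rank_one_in)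
    define C' where "C' k = S (n k) y \<otimes>\<^sub>r f + C k" for k
    have SJ: "S (n k) y \<otimes>\<^sub>r f \<in> J" for k using f by (rule rank_one_in)
    have C'J: "C' k \<in> J" for k unfolding C'_def by (intro closed_under SJ C)
    let ?b = "\<lambda>k. norm ((blinfun_apply T ^^ n k) (S (n k) y) - y) * norm f
      + N ((left_mult T ^^ n k) (C k) - B)"
    have lim: "?b \<longlonglongrightarrow> 0 * norm f + 0"
      by (intro tendsto_add tendsto_mult_right inv y C)
    have "N ((left_mult T ^^ n k) (C' k) - (R + B)) \<le> ?b k" for k
    proof -
      have "(left_mult T ^^ n k) (C' k) - (R + B)
        = ((left_mult T ^^ n k) (S (n k) y \<otimes>\<^sub>r f) - R) + ((left_mult T ^^ n k) (C k) - B)"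
        unfolding C'_def by (simp add: Lnadd SJ C)
      also have "N \<dots> \<le> N ((left_mult T ^^ n k) (S (n k) y \<otimes>\<^sub>r f) - R) + N ((left_mult T ^^ n k) (C k) - B)"
        by (intro triangle closed_under LnJ SJ C RJ B)
      also have "N ((left_mult T ^^ n k) (S (n k) y \<otimes>\<^sub>r f) - R)
          = norm ((blinfun_apply T ^^ n k) (S (n k) y) - y) * norm f"
        by (simp add: R left_mult_power_rank_one[OF T] rank_one_diff rank_one_norm f)
      finally show ?thesis .
    qed
    then have "(\<lambda>k. N ((left_mult T ^^ n k) (C' k) - (R + B))) \<longlonglongrightarrow> 0"
      using lim by (intro tendsto_sandwich[OF _ _ tendsto_const lim[simplified]])
        (auto intro!: always_eventually nonneg LnJ closed_under C'J RJ B)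
    moreover have "(\<lambda>k. N ((left_mult T ^^ n k) A) * N (C' k)) \<longlonglongrightarrow> 0" if A: "A \<in> E D1" for A
    proof -
      have AJ: "A \<in> J" using A EJ by blast
      let ?b = "\<lambda>k. (N ((left_mult T ^^ n k) A) * norm (S (n k) y)) * norm f
        + N ((left_mult T ^^ n k) A) * N (C k)"
      have lim: "?b \<longlonglongrightarrow> 0 * norm f + 0"
        by (intro tendsto_add tendsto_mult_right smallE y A C)
      have "N ((left_mult T ^^ n k) A) * N (C' k) \<le> ?b k" for k
      proof -
        have "N (C' k) \<le> N (S (n k) y \<otimes>\<^sub>r f) + N (C k)" unfolding C'_def by (intro triangle SJ C)
        also have "N (S (n k) y \<otimes>\<^sub>r f) = norm (S (n k) y) * norm f" by (rule rank_one_norm[OF f])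
        finally have "N ((left_mult T ^^ n k) A) * N (C' k)
            \<le> N ((left_mult T ^^ n k) A) * (norm (S (n k) y) * norm f + N (C k))"
          by (intro mult_left_mono nonneg LnJ AJ)
        then show ?thesis by (simp add: algebra_simps)
      qed
      then show ?thesis
        using lim by (intro tendsto_sandwich[OF _ _ tendsto_const lim[simplified]])
          (auto intro!: always_eventually mult_nonneg_nonneg nonneg LnJ C'J AJ)
    qed
    ultimately show ?case using C'J by (intro exI[of _ C']) auto
  qed
  then show ?thesis
    by (intro L.transitive_imp_supercyclic[OF sep] L.criterion_imp_transitive[OF E])
qed

end

section \<open>Recovering the criterion from a diagonal orbit\<close>

lemma bounded_linear_funpow:
  fixes T :: "'a::real_normed_vector \<Rightarrow>\<^sub>L 'a"
  shows "bounded_linear (blinfun_apply T ^^ n)"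
proof (induction n)
  case 0
  show ?case by (simp add: id_def)
next
  case (Suc n)
  then show ?case
    using bounded_linear_compose[OF blinfun.bounded_linear_right[of T] Suc] by (simp add: o_def)
qed

lemma funpow_scaleC:
  assumes "T \<in> bounded_operators"
  shows "(blinfun_apply T ^^ n) (c *\<^sub>C z) = c *\<^sub>C (blinfun_apply T ^^ n) z"
  using assms by (induction n) (simp_all add: bounded_operators_def clinear_iff)

lemma funpow_commute: "(f ^^ m) ((f ^^ n) z) = (f ^^ n) ((f ^^ m) z)"
  by (metis add.commute comp_apply funpow_add)

text \<open>Density is applied at \<open>(v, s x)\<close> with \<open>v\<close> small but nonzero. If \<open>n \<le> M\<close>, then \<open>T\<^sup>n x \<noteq> 0\<close> and
  \<open>\<bar>\<alpha>\<bar>\<close> is bounded by a constant that does not depend on \<open>s\<close>, hence so is \<open>\<alpha> T\<^sup>n y\<close>; this is impossible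
  when \<open>s\<close> is large. Having \<open>n\<close> as large as desired allows a strictly increasing sequence of exponents.\<close>
lemma escaping_approximation:
  fixes T :: "'a::complex_normed_vector \<Rightarrow>\<^sub>L 'a" and x y :: 'a
  assumes x: "x \<noteq> 0" and e: "0 < e"
    and pair: "\<And>a b e. 0 < e \<Longrightarrow> \<exists>\<alpha> n. norm (\<alpha> *\<^sub>C (blinfun_apply T ^^ n) x - a) < e \<and>
        norm (\<alpha> *\<^sub>C (blinfun_apply T ^^ n) y - b) < e"
  shows "\<exists>n>M. \<exists>\<alpha> s. 1 / e \<le> s \<and> norm (\<alpha> *\<^sub>C (blinfun_apply T ^^ n) x) < e \<and>
        norm (\<alpha> *\<^sub>C (blinfun_apply T ^^ n) y - complex_of_real s *\<^sub>C x) < e"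
proof -
  define v where "v = (e / 2 / norm x) *\<^sub>R x"
  have v: "norm v = e / 2" using x e by (simp add: v_def)
  \<comment> \<open>Terms with \<open>T\<^sup>n x = 0\<close> vanish, as division by zero gives zero.\<close>
  define C where "C = (\<Sum>n\<le>M. e * (norm ((blinfun_apply T ^^ n) y) / norm ((blinfun_apply T ^^ n) x)))"
  define s where "s = max (1 / e) ((C + e) / norm x)"
  have s: "C + e \<le> s * norm x" "1 / e \<le> s" using x by (simp_all add: s_def pos_divide_le_eq[symmetric])
  obtain \<alpha> n where n: "norm (\<alpha> *\<^sub>C (blinfun_apply T ^^ n) x - v) < e / 4"
    "norm (\<alpha> *\<^sub>C (blinfun_apply T ^^ n) y - complex_of_real s *\<^sub>C x) < e / 4"
    using pair[of "e / 4" v "complex_of_real s *\<^sub>C x"] e by auto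
  have small: "norm (\<alpha> *\<^sub>C (blinfun_apply T ^^ n) x) < e"
    using norm_triangle_sub[of "\<alpha> *\<^sub>C (blinfun_apply T ^^ n) x" v] n(1) v e by simp
  have "\<not> n \<le> M"
  proof
    assume nM: "n \<le> M"
    have nz: "(blinfun_apply T ^^ n) x \<noteq> 0" using n(1) v e by auto
    have "norm (\<alpha> *\<^sub>C (blinfun_apply T ^^ n) y)
        = norm (\<alpha> *\<^sub>C (blinfun_apply T ^^ n) x) *
          (norm ((blinfun_apply T ^^ n) y) / norm ((blinfun_apply T ^^ n) x))"
      using nz by (simp add: norm_scaleC)
    also have "\<dots> \<le> e * (norm ((blinfun_apply T ^^ n) y) / norm ((blinfun_apply T ^^ n) x))"
      using small by (intro mult_right_mono) auto
    also have "\<dots> \<le> C"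
      unfolding C_def using nM e
      by (intro member_le_sum[where f = "\<lambda>n. e * (norm ((blinfun_apply T ^^ n) y) / norm ((blinfun_apply T ^^ n) x))"]) auto
    finally have "norm (\<alpha> *\<^sub>C (blinfun_apply T ^^ n) y) \<le> C" .
    moreover have "0 \<le> s" using s(2) e by (meson divide_nonneg_pos le_less_trans less_eq_real_def order.trans zero_le_one)
    then have "norm (complex_of_real s *\<^sub>C x) = s * norm x" by (simp add: norm_scaleC)
    ultimately show False
      using norm_triangle_sub[of "complex_of_real s *\<^sub>C x" "\<alpha> *\<^sub>C (blinfun_apply T ^^ n) y"]
        n(2) s(1) e by (simp add: norm_minus_commute)
  qed
  moreover have "norm (\<alpha> *\<^sub>C (blinfun_apply T ^^ n) y - complex_of_real s *\<^sub>C x) < e"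
    using n(2) e by simp
  ultimately show ?thesis using small s(2) by (meson not_le)
qed

text \<open>With \<open>\<alpha>\<^sub>k T\<^bsup>n k\<^esup> x \<rightarrow> 0\<close> and \<open>(\<alpha>\<^sub>k / s\<^sub>k) T\<^bsup>n k\<^esup> y \<rightarrow> x\<close>, where \<open>s\<^sub>k \<rightarrow> \<infinity>\<close>, put
  \<open>S\<^bsub>n k\<^esub> (\<beta> T\<^sup>m x) = (\<alpha>\<^sub>k / s\<^sub>k) \<beta> T\<^sup>m y\<close>. In the product of norms, \<open>\<alpha>\<^sub>k\<close> can be moved to the
  first factor, which then tends to zero, as does \<open>1 / s\<^sub>k\<close> in the second.\<close>
lemma dense_diagonal_orbit_imp_criterion:
  fixes T :: "'a::complex_normed_vector \<Rightarrow>\<^sub>L 'a" and x y :: 'a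
  assumes T: "T \<in> bounded_operators" and x: "x \<noteq> 0"
    and pair: "\<And>a b e. 0 < e \<Longrightarrow> \<exists>\<alpha> n. norm (\<alpha> *\<^sub>C (blinfun_apply T ^^ n) x - a) < e \<and>
        norm (\<alpha> *\<^sub>C (blinfun_apply T ^^ n) y - b) < e"
  shows "supercyclicity_criterion UNIV norm (blinfun_apply T)"
proof -
  let ?T = "\<lambda>n. blinfun_apply T ^^ n"
  have TC: "?T n (c *\<^sub>C z) = c *\<^sub>C ?T n z" for n c z by (rule funpow_scaleC[OF T])
  define good where "good k = (\<lambda>(n, \<alpha>, s). real (Suc k) \<le> s \<and>
      norm (\<alpha> *\<^sub>C ?T n x) < inverse (Suc k) \<and>
      norm (\<alpha> *\<^sub>C ?T n y - complex_of_real s *\<^sub>C x) < inverse (Suc k))" for k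
  have ex: "\<exists>n>M. \<exists>\<alpha> s. good k (n, \<alpha>, s)" for M k
    using escaping_approximation[OF x _ pair, of "inverse (Suc k)" M]
    by (simp add: good_def divide_inverse del: of_nat_Suc)
  have "\<exists>f. \<forall>k. (good k (f k) \<and> 0 < fst (f k)) \<and> fst (f k) < fst (f (Suc k))"
  proof (rule dependent_nat_choice)
    show "\<exists>p. good 0 p \<and> 0 < fst p" using ex[of 0 0] by force
    show "\<exists>q. (good (Suc k) q \<and> 0 < fst q) \<and> fst p < fst q" if "good k p \<and> 0 < fst p" for p k
      using ex[of "fst p" "Suc k"] that by force
  qed
  then obtain f where f: "\<And>k. good k (f k)" "\<And>k. 0 < fst (f k)" "\<And>k. fst (f k) < fst (f (Suc k))"
    by blast
  define n where "n k = fst (f k)" for k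
  define \<alpha> where "\<alpha> k = fst (snd (f k))" for k
  define s where "s k = snd (snd (f k))" for k
  have n_pos: "0 < n k" for k using f(2) by (simp add: n_def)
  have "strict_mono n" using f(3) by (simp add: strict_mono_Suc_iff n_def)
  then have inv_n: "inv n (n k) = k" for k by (simp add: strict_mono_imp_inj_on)
  have s_ge: "real (Suc k) \<le> s k"
    and x_lt: "norm (\<alpha> k *\<^sub>C ?T (n k) x) < inverse (Suc k)"
    and y_lt: "norm (\<alpha> k *\<^sub>C ?T (n k) y - complex_of_real (s k) *\<^sub>C x) < inverse (Suc k)" for k
    using f(1)[of k] unfolding good_def n_def \<alpha>_def s_def split_beta by blast+
  have s_pos: "0 < s k" for k using s_ge[of k] by simp
  have null: "(\<lambda>k. inverse (real (Suc k))) \<longlonglongrightarrow> 0" by (rule LIMSEQ_inverse_real_of_nat)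
  have x_lim: "(\<lambda>k. \<alpha> k *\<^sub>C ?T (n k) x) \<longlonglongrightarrow> 0"
    by (rule Lim_null_comparison[OF always_eventually null]) (intro allI less_imp_le x_lt)
  have s_lim: "(\<lambda>k. 1 / s k) \<longlonglongrightarrow> 0"
  proof (rule Lim_null_comparison[OF _ null])
    have "norm (1 / s k) \<le> inverse (real (Suc k))" for k
      using s_ge[of k] s_pos[of k] by (simp add: divide_simps)
    then show "\<forall>\<^sub>F k in sequentially. norm (1 / s k) \<le> inverse (real (Suc k))" by simp
  qed
  have y_lim: "(\<lambda>k. complex_of_real (1 / s k) *\<^sub>C \<alpha> k *\<^sub>C ?T (n k) y) \<longlonglongrightarrow> x"
  proof (rule LIM_zero_cancel, rule Lim_null_comparison[OF _ s_lim])
    have "norm (complex_of_real (1 / s k) *\<^sub>C \<alpha> k *\<^sub>C ?T (n k) y - x) \<le> 1 / s k" for k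
    proof -
      have "complex_of_real (1 / s k) *\<^sub>C complex_of_real (s k) *\<^sub>C x = x"
        using s_pos[of k] by (simp add: scaleC_scaleC scaleC_one flip: of_real_mult)
      then have "complex_of_real (1 / s k) *\<^sub>C \<alpha> k *\<^sub>C ?T (n k) y - x
        = complex_of_real (1 / s k) *\<^sub>C (\<alpha> k *\<^sub>C ?T (n k) y - complex_of_real (s k) *\<^sub>C x)"
        by (simp add: complex_vector.scale_right_diff_distrib)
      also have "norm \<dots> = 1 / s k * norm (\<alpha> k *\<^sub>C ?T (n k) y - complex_of_real (s k) *\<^sub>C x)"
        using s_pos[of k] by (simp add: norm_scaleC norm_divide)
      also have "\<dots> \<le> 1 / s k * 1"
      proof (intro mult_left_mono)
        have "inverse (real (Suc k)) \<le> 1" by (simp add: divide_simps)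
        then show "norm (\<alpha> k *\<^sub>C ?T (n k) y - complex_of_real (s k) *\<^sub>C x) \<le> 1"
          using y_lt[of k] by linarith
      qed (use s_pos[of k] in simp)
      finally show ?thesis by simp
    qed
    then show "\<forall>\<^sub>F k in sequentially.
        norm (complex_of_real (1 / s k) *\<^sub>C \<alpha> k *\<^sub>C ?T (n k) y - x) \<le> 1 / s k" by simp
  qed
  define D where "D = {\<beta> *\<^sub>C ?T m x | \<beta> m. True}"
  have dense: "dense_wrt UNIV norm D"
    unfolding dense_wrt_def
  proof (intro conjI ballI allI impI)
    fix a :: 'a and e :: real assume "0 < e"
    then obtain \<beta> m where "norm (\<beta> *\<^sub>C ?T m x - a) < e" using pair[of e a a] by blast
    then have "norm (a - \<beta> *\<^sub>C ?T m x) < e" by (simp add: norm_minus_commute)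
    then show "\<exists>d\<in>D. norm (a - d) < e" unfolding D_def by blast
  qed simp
  have "\<exists>\<beta> m. d = \<beta> *\<^sub>C ?T m x" if "d \<in> D" for d using that by (auto simp: D_def)
  \<comment> \<open>A vector may have several representations; fixing one makes \<open>S\<close> well defined.\<close>
  then obtain \<beta> m where rep: "\<And>d. d \<in> D \<Longrightarrow> d = \<beta> d *\<^sub>C ?T (m d) x" by metis
  \<comment> \<open>The maps are indexed by exponents, so \<open>k\<close> is recovered from \<open>n k\<close> by injectivity.\<close>
  define S where "S j d = (let k = inv n j in
      complex_of_real (1 / s k) *\<^sub>C \<alpha> k *\<^sub>C \<beta> d *\<^sub>C ?T (m d) y)" for j d
  have S: "S (n k) d = complex_of_real (1 / s k) *\<^sub>C \<alpha> k *\<^sub>C \<beta> d *\<^sub>C ?T (m d) y" for k d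
    by (simp add: S_def inv_n)
  have lim_T: "(\<lambda>k. c *\<^sub>C ?T i (z k)) \<longlonglongrightarrow> c *\<^sub>C ?T i w" if "z \<longlonglongrightarrow> w" for c i z w
    by (intro bounded_linear.tendsto[OF bounded_linear_scaleC_right]
        bounded_linear.tendsto[OF bounded_linear_funpow] that)
  have prod: "(\<lambda>k. norm (?T (n k) d) * norm (S (n k) d')) \<longlonglongrightarrow> 0" if d: "d \<in> D" and d': "d' \<in> D" for d d'
  proof -
    have eq: "norm (?T (n k) d) * norm (S (n k) d')
      = norm (\<beta> d *\<^sub>C ?T (m d) (\<alpha> k *\<^sub>C ?T (n k) x)) * (1 / s k) * norm (\<beta> d' *\<^sub>C ?T (m d') y)" for k
    proof -
      have "?T (n k) d = \<beta> d *\<^sub>C ?T (m d) (?T (n k) x)"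
        by (subst rep[OF d]) (simp add: TC funpow_commute)
      then show ?thesis
        using s_pos[of k] by (simp add: S norm_scaleC norm_divide norm_mult TC)
    qed
    have "(\<lambda>k. norm (\<beta> d *\<^sub>C ?T (m d) (\<alpha> k *\<^sub>C ?T (n k) x)) * (1 / s k) * norm (\<beta> d' *\<^sub>C ?T (m d') y))
      \<longlonglongrightarrow> norm (\<beta> d *\<^sub>C ?T (m d) 0) * 0 * norm (\<beta> d' *\<^sub>C ?T (m d') y)"
      by (intro tendsto_mult_right tendsto_mult tendsto_norm lim_T x_lim s_lim)
    then show ?thesis by (simp add: eq)
  qed
  have inverse: "(\<lambda>k. norm (?T (n k) (S (n k) d) - d)) \<longlonglongrightarrow> 0" if d: "d \<in> D" for d
  proof -
    have eq: "?T (n k) (S (n k) d)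
      = \<beta> d *\<^sub>C ?T (m d) (complex_of_real (1 / s k) *\<^sub>C \<alpha> k *\<^sub>C ?T (n k) y)" for k
      using funpow_commute[of "n k" "blinfun_apply T" "m d" y]
      by (simp add: S TC scaleC_scaleC mult_ac)
    have "(\<lambda>k. ?T (n k) (S (n k) d)) \<longlonglongrightarrow> \<beta> d *\<^sub>C ?T (m d) x"
      unfolding eq by (intro lim_T y_lim)
    then have "(\<lambda>k. ?T (n k) (S (n k) d)) \<longlonglongrightarrow> d" using rep[OF d] by simp
    then show ?thesis by (intro tendsto_norm_zero LIM_zero)
  qed
  show ?thesis
    unfolding supercyclicity_criterion_def
  proof (intro exI conjI)
    show "dense_wrt UNIV norm D" "dense_wrt UNIV norm D" by (fact dense)+
    show "\<forall>k. 0 < n k" using n_pos by blast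
    show "\<forall>k. \<forall>d\<in>D. S (n k) d \<in> UNIV" by simp
    show "\<forall>d\<in>D. \<forall>d'\<in>D. (\<lambda>k. norm (?T (n k) d) * norm (S (n k) d')) \<longlonglongrightarrow> 0" using prod by blast
    show "\<forall>d\<in>D. (\<lambda>k. norm (?T (n k) (S (n k) d) - d)) \<longlonglongrightarrow> 0" using inverse by blast
  qed
qed

text \<open>Evaluation at \<open>a\<close> and \<open>b\<close> carries the dense projective orbit of \<open>R\<close> to that of
  \<open>(R a, R b)\<close>: it is continuous because the operator norm is at most the ideal norm, and
  \<open>p \<otimes> f + q \<otimes> g\<close> is a preimage of \<open>(p, q)\<close>.\<close>
lemma (in banach_ideal) left_mult_supercyclic_imp_criterion:
  assumes T: "T \<in> bounded_operators" and sup: "supercyclic J N (left_mult T)"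
    and u: "u \<noteq> 0" and w: "\<And>c. w \<noteq> c *\<^sub>C (u :: 'a)"
  shows "supercyclicity_criterion UNIV norm (blinfun_apply T)"
proof -
  obtain f g :: "'a \<Rightarrow>\<^sub>L complex" and a b :: 'a where f: "f \<in> dual_space" and g: "g \<in> dual_space"
    and fg: "f a = 1" "f b = 0" "g a = 0" "g b = 1"
    using biorthogonal_pair[OF u w] by blast
  obtain R where R: "R \<in> J" and dense: "dense_wrt J N {\<alpha> *\<^sub>C (left_mult T ^^ n) R | \<alpha> n. True}"
    using sup unfolding supercyclic_def by blast
  interpret L: bounded_operator_on J N "left_mult T" "norm T"
    by (rule left_mult_bounded_operator_on[OF T])
  have pair: "\<exists>\<alpha> n. norm (\<alpha> *\<^sub>C (blinfun_apply T ^^ n) (R a) - p) < e \<and>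
      norm (\<alpha> *\<^sub>C (blinfun_apply T ^^ n) (R b) - q) < e" if e: "0 < e" for p q e
  proof -
    define A where "A = p \<otimes>\<^sub>r f + q \<otimes>\<^sub>r g"
    have A: "A \<in> J" unfolding A_def by (intro closed_under rank_one_in f g)
    have Aab: "A a = p" "A b = q"
      using fg by (simp_all add: A_def blinfun.add_left rank_one.rep_eq scaleC_one)
    define K where "K = norm a + norm b + 1"
    have K: "0 < K" by (simp add: K_def add_nonneg_pos)
    have "0 < e / K" using e K by simp
    then obtain d where "d \<in> {\<alpha> *\<^sub>C (left_mult T ^^ n) R | \<alpha> n. True}" "N (A - d) < e / K"
      using dense A unfolding dense_wrt_def by meson
    then obtain \<alpha> n where lt: "N (A - \<alpha> *\<^sub>C (left_mult T ^^ n) R) < e / K" by blast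
    define E where "E = A - \<alpha> *\<^sub>C (left_mult T ^^ n) R"
    have "E \<in> J" unfolding E_def
      by (intro closed_under A bounded_operator_on.maps[OF L.iterate_operator] R)
    then have E: "norm E < e / K" using lt norm_le[of E] by (simp add: E_def)
    have close: "norm (\<alpha> *\<^sub>C (blinfun_apply T ^^ n) (R z) - A z) < e" if "norm z \<le> K" for z
    proof -
      have "norm (\<alpha> *\<^sub>C (blinfun_apply T ^^ n) (R z) - A z) = norm (E z)"
        by (simp add: E_def blinfun.diff_left scaleC_blinfun.rep_eq left_mult_power_apply
            norm_minus_commute)
      also have "\<dots> \<le> norm E * norm z" by (rule norm_blinfun)
      also have "\<dots> \<le> norm E * K" using that by (intro mult_left_mono) auto
      also have "\<dots> < e" using E K by (simp add: pos_less_divide_eq)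
      finally show ?thesis .
    qed
    show ?thesis
      using close[of a] close[of b] Aab by (intro exI[of _ \<alpha>] exI[of _ n]) (auto simp: K_def)
  qed
  have "R a \<noteq> 0"
  proof
    assume "R a = 0"
    moreover obtain \<alpha> n where "norm (\<alpha> *\<^sub>C (blinfun_apply T ^^ n) (R a) - u) < norm u"
      using pair[of "norm u" u u] u by auto
    ultimately show False
      using linear_0[OF bounded_linear.linear[OF bounded_linear_funpow[of n T]]] by simp
  qed
  then show ?thesis by (rule dense_diagonal_orbit_imp_criterion[OF T _ pair])
qed

theorem theorem2p2:
  fixes T :: "'a::complex_banach \<Rightarrow>\<^sub>L 'a"
    and J :: "('a \<Rightarrow>\<^sub>L 'a) set" and N :: "('a \<Rightarrow>\<^sub>L 'a) \<Rightarrow> real"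
  assumes dim_gt_1: "\<exists>B :: 'a set. complex_vector.independent B \<and> complex_vector.span B = UNIV
      \<and> (infinite B \<or> card B > 1)"
    and "separable_wrt (dual_space :: ('a \<Rightarrow>\<^sub>L complex) set) norm"
    and "admissible_banach_ideal J N"
    and "separable_wrt J N"
    and "T \<in> bounded_operators"
  shows "supercyclicity_criterion (UNIV :: 'a set) norm (blinfun_apply T) \<longleftrightarrow>
    supercyclic J N (left_mult T)"
proof
  interpret admissible_banach_ideal J N by fact
  show "supercyclic J N (left_mult T)"
    if "supercyclicity_criterion (UNIV :: 'a set) norm (blinfun_apply T)"
    by (rule criterion_imp_left_mult_supercyclic) fact+
  show "supercyclicity_criterion (UNIV :: 'a set) norm (blinfun_apply T)"
    if "supercyclic J N (left_mult T)"
  proof -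
    obtain B :: "'a set" where B: "complex_vector.independent B" "infinite B \<or> card B > 1"
      using dim_gt_1 by blast
    then have "\<not> is_singleton B" "B \<noteq> {}" by (auto simp: is_singleton_altdef)
    then obtain u w where uw: "u \<in> B" "w \<in> B" "u \<noteq> w" by (metis all_not_in_conv is_singletonI')
    have "u \<noteq> 0" using B(1) uw(1) complex_vector.dependent_zero by blast
    moreover have "w \<noteq> c *\<^sub>C u" for c
    proof
      assume "w = c *\<^sub>C u"
      then have "w \<in> complex_vector.span (B - {w})"
        using uw by (auto intro: complex_vector.span_scale complex_vector.span_base)
      then show False using B(1) uw(2) complex_vector.dependent_def by blast
    qed
    ultimately show ?thesis
      using left_mult_supercyclic_imp_criterion[OF assms(5) that] by blast
  qed
qed

end
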